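(* Let $M\ge2$. Observe $\mathbf y=\mathbf f+\boldsymbol\xi$ with $\xi_1,\dots,\xi_n$ i.i.d. $\mathcal N(0,\sigma^2)$. For $j=1,\dots,M$ let $\hat{\boldsymbol\mu}_j=A_j\mathbf y+\mathbf b_j$ with deterministic $\mathbf b_j\in\mathbf R^n$ and deterministic $n\times n$ matrices satisfying $A_j=A_j^T=A_j^2$. Let $\hat\sigma^2$ be an estimator with $\delta:=\mathbb P(|\sigma^2-\hat\sigma^2|>\sigma^2/8)<1$. Let $\hat{\boldsymbol\theta}_{\hat\sigma}\in\arg\min_{\boldsymbol\theta\in\Lambda^M}W_{\mathrm{pen}}(\boldsymbol\theta)$ where \[W_{\mathrm{pen}}(\boldsymbol\theta)=\|\hat{\boldsymbol\mu}_{\boldsymbol\theta}\|_2^2-2\mathbf y^T\hat{\boldsymbol\mu}_{\boldsymbol\theta}+2\hat\sigma^2\mathrm{Tr}(A_{\boldsymbol\theta})+\tfrac12\mathrm{pen}(\boldsymbol\theta).\] Then for all $x>0$, with probability at least $1-\delta-2e^{-x}$, \[\|\hat{\boldsymbol\mu}_{\hat{\boldsymbol\theta}_{\hat\sigma}}-\mathbf f\|_2^2\le\min_{j=1,\dots,M}\|\hat{\boldsymbol\mu}_j-\mathbf f\|_2^2+64\sigma^2(x+2\log M).\]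
   Context: $\Lambda^M=\{\boldsymbol\theta\in\mathbf R^M:\sum_j\theta_j=1,\theta_j\ge0\}$. For $\boldsymbol\theta\in\Lambda^M$: $A_{\boldsymbol\theta}=\sum_j\theta_jA_j$, $\mathbf b_{\boldsymbol\theta}=\sum_j\theta_j\mathbf b_j$, $\hat{\boldsymbol\mu}_{\boldsymbol\theta}=A_{\boldsymbol\theta}\mathbf y+\mathbf b_{\boldsymbol\theta}$, and $\mathrm{pen}(\boldsymbol\theta)=\sum_j\theta_j\|\hat{\boldsymbol\mu}_{\boldsymbol\theta}-\hat{\boldsymbol\mu}_j\|_2^2$. *)

theory Defs
  imports "HOL-Probability.Probability"
begin

definition Lambda_simplex :: "(real ^ 'm::finite) set" where
  "Lambda_simplex = {\<theta>. sum (\<lambda>j. \<theta> $ j) UNIV = 1 \<and> (\<forall>j. 0 \<le> \<theta> $ j)}"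

definition A_theta :: "('m::finite \<Rightarrow> real ^ 'n ^ 'n) \<Rightarrow> real ^ 'm \<Rightarrow> real ^ 'n ^ 'n" where
  "A_theta A \<theta> = (\<Sum>j\<in>UNIV. (\<theta> $ j) *\<^sub>R A j)"

definition b_theta :: "('m::finite \<Rightarrow> real ^ 'n) \<Rightarrow> real ^ 'm \<Rightarrow> real ^ 'n" where
  "b_theta b \<theta> = (\<Sum>j\<in>UNIV. (\<theta> $ j) *\<^sub>R b j)"

definition mu_j :: "('m \<Rightarrow> real ^ 'n ^ 'n) \<Rightarrow> ('m \<Rightarrow> real ^ 'n) \<Rightarrow> real ^ 'n \<Rightarrow> 'm \<Rightarrow> real ^ 'n" where
  "mu_j A b y j = A j *v y + b j"

definition mu_theta :: "('m::finite \<Rightarrow> real ^ 'n ^ 'n) \<Rightarrow> ('m \<Rightarrow> real ^ 'n) \<Rightarrow> real ^ 'n \<Rightarrow> real ^ 'm \<Rightarrow> real ^ 'n" where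
  "mu_theta A b y \<theta> = A_theta A \<theta> *v y + b_theta b \<theta>"

definition pen :: "('m::finite \<Rightarrow> real ^ 'n ^ 'n) \<Rightarrow> ('m \<Rightarrow> real ^ 'n) \<Rightarrow> real ^ 'n \<Rightarrow> real ^ 'm \<Rightarrow> real" where
  "pen A b y \<theta> = (\<Sum>j\<in>UNIV. (\<theta> $ j) * (norm (mu_theta A b y \<theta> - mu_j A b y j))\<^sup>2)"

text \<open>W_pen(theta) with plug-in variance estimate s2 (= sigma-hat squared).\<close>
definition Wpen :: "('m::finite \<Rightarrow> real ^ 'n ^ 'n) \<Rightarrow> ('m \<Rightarrow> real ^ 'n) \<Rightarrow> real ^ 'n \<Rightarrow> real \<Rightarrow> real ^ 'm \<Rightarrow> real" where
  "Wpen A b y s2 \<theta> =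
     (norm (mu_theta A b y \<theta>))\<^sup>2 - 2 * (y \<bullet> mu_theta A b y \<theta>)
     + 2 * s2 * trace (A_theta A \<theta>) + (1/2) * pen A b y \<theta>"

end

theory Submission
  imports Defs
begin

text \<open>
  The criterion \<open>Wpen\<close> is a quadratic function on the simplex, so first-order optimality of the
  minimiser bounds its excess loss over the estimator \<open>k\<close> by an average over \<open>j\<close> (with weights
  \<open>\<theta> $ j\<close>) of quantities depending only on the pair \<open>(j, k)\<close>; the penalty contributes
  \<open>- |\<mu>\<^sub>j - \<mu>\<^sub>k|\<^sup>2 / 2\<close> to each of them. For orthogonal projections, \<open>|tr D| \<le> tr (D\<^sup>2)\<close> with
  \<open>D = A\<^sub>j - A\<^sub>k\<close>, so the error of the variance estimator costs at most half of the mean of that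
  negative term. Diagonalising \<open>D\<close> shows that the resulting quadratic form in the Gaussian noise has
  exponential moment at most 1 at \<open>1 / (64 \<sigma>\<^sup>2)\<close>. Markov's inequality and a union bound over the
  \<open>M\<^sup>2\<close> pairs conclude.
\<close>

section \<open>Spectral theorem for self-adjoint operators\<close>

text \<open>A maximiser \<open>u\<close> of the Rayleigh quotient over the unit sphere of
  \<open>V\<close> is an eigenvector: invariance of \<open>V\<close> keeps the residual
  \<open>w = T u - c *\<^sub>R u\<close> in \<open>V\<close>, so \<open>u\<close> may be moved in
  that direction, and optimality forces \<open>w = 0\<close>.\<close>

lemma self_adjoint_eigenvector_in_subspace:
  fixes T :: "'a::euclidean_space \<Rightarrow> 'a"
  assumes lin: "linear T" and adj: "\<And>x y. T x \<bullet> y = x \<bullet> T y"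
    and V: "subspace V" and inv: "\<And>x. x \<in> V \<Longrightarrow> T x \<in> V" and ne: "V \<noteq> {0}"
  obtains u c where "u \<in> V" "norm u = 1" "T u = c *\<^sub>R u"
proof -
  obtain v where v: "v \<in> V" "v \<noteq> 0"
    using ne subspace_0[OF V] by auto
  let ?K = "sphere 0 1 \<inter> V"
  have "compact ?K"
    using closed_subspace[OF V] by (simp add: compact_Int_closed)
  moreover have "v /\<^sub>R norm v \<in> ?K"
    using v V by (simp add: subspace_scale)
  moreover have "continuous_on ?K (\<lambda>x. x \<bullet> T x)"
    using lin by (intro continuous_intros linear_continuous_on) (simp add: linear_conv_bounded_linear)
  ultimately obtain u where u: "u \<in> ?K" and max: "\<And>x. x \<in> ?K \<Longrightarrow> x \<bullet> T x \<le> u \<bullet> T u"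
    using continuous_attains_sup[of ?K "\<lambda>x. x \<bullet> T x"] by blast
  define c where "c = u \<bullet> T u"
  have uu: "u \<bullet> u = 1"
    using u by (simp add: dot_square_norm)
  have le: "x \<bullet> T x \<le> c * (x \<bullet> x)" if "x \<in> V" for x
  proof (cases "x = 0")
    case False
    have "x /\<^sub>R norm x \<in> ?K"
      using that V False by (simp add: subspace_scale)
    from max[OF this] show ?thesis
      using False
      by (simp add: c_def linear_scale[OF lin] dot_square_norm field_simps power2_eq_square)
  qed simp
  define w where "w = T u - c *\<^sub>R u"
  have wV: "w \<in> V"
    unfolding w_def using u V inv by (simp add: subspace_diff subspace_scale)
  have wu: "w \<bullet> u = 0"
    using adj[of u u] by (simp add: w_def inner_diff_left c_def uu)
  have wT: "w \<bullet> T u = w \<bullet> w"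
    using wu by (simp add: w_def inner_diff_left inner_diff_right inner_commute)
  \<comment> \<open>First-order optimality of the maximiser \<open>u\<close> in the direction \<open>w\<close>.\<close>
  have key: "2 * e * (w \<bullet> w) \<le> e\<^sup>2 * (c * (w \<bullet> w) - w \<bullet> T w)" for e
  proof -
    have "(u + e *\<^sub>R w) \<bullet> T (u + e *\<^sub>R w) \<le> c * ((u + e *\<^sub>R w) \<bullet> (u + e *\<^sub>R w))"
      using u wV V by (intro le) (simp add: subspace_add subspace_scale)
    moreover have "(u + e *\<^sub>R w) \<bullet> T (u + e *\<^sub>R w) = c + 2 * e * (w \<bullet> w) + e\<^sup>2 * (w \<bullet> T w)"
      using wT adj[of u w]
      by (simp add: linear_add[OF lin] linear_scale[OF lin] inner_add_left inner_add_right
          c_def power2_eq_square algebra_simps inner_commute)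
    moreover have "(u + e *\<^sub>R w) \<bullet> (u + e *\<^sub>R w) = 1 + e\<^sup>2 * (w \<bullet> w)"
      using wu by (simp add: inner_add_left inner_add_right uu power2_eq_square inner_commute)
    ultimately have "c + 2 * e * (w \<bullet> w) + e\<^sup>2 * (w \<bullet> T w) \<le> c * (1 + e\<^sup>2 * (w \<bullet> w))"
      by simp
    then show ?thesis
      by (simp add: algebra_simps)
  qed
  have "w \<bullet> w \<le> 0"
  proof (rule ccontr)
    assume "\<not> w \<bullet> w \<le> 0"
    then have pos: "w \<bullet> w > 0" by linarith
    \<comment> \<open>With this \<open>e\<close> the right-hand side of \<open>key\<close> is at
      most \<open>e * (w \<bullet> w)\<close>, only half of its positive left-hand side. The summand
      1 keeps \<open>k\<close> positive.\<close>
    define k where "k = \<bar>c * (w \<bullet> w) - w \<bullet> T w\<bar> + 1"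
    define e where "e = (w \<bullet> w) / k"
    have k: "k > 0" "c * (w \<bullet> w) - w \<bullet> T w \<le> k"
      by (auto simp: k_def)
    have e: "e > 0" "e * k = w \<bullet> w" using pos k by (auto simp: e_def)
    have "2 * e * (w \<bullet> w) \<le> e\<^sup>2 * k"
      using key[of e] k by (meson mult_left_mono order_trans zero_le_power2)
    also have "\<dots> = e * (w \<bullet> w)" using e by (simp add: power2_eq_square)
    finally show False using e pos by simp
  qed
  then have "w = 0" using inner_gt_zero_iff[of w] by linarith
  then show ?thesis
    using u that[of u c] by (auto simp: w_def)
qed

text \<open>An orthonormal set of eigenvectors of largest cardinality spans: its orthogonal
  complement is invariant because \<open>T\<close> is self-adjoint, and if nonzero it would contain
  a further eigenvector.\<close>

lemma self_adjoint_orthonormal_eigenbasis: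
  fixes T :: "'a::euclidean_space \<Rightarrow> 'a"
  assumes lin: "linear T" and adj: "\<And>x y. T x \<bullet> y = x \<bullet> T y"
  obtains B where "pairwise orthogonal B" "finite B" "card B = DIM('a)"
    "\<And>u. u \<in> B \<Longrightarrow> norm u = 1" "\<And>u. u \<in> B \<Longrightarrow> \<exists>c. T u = c *\<^sub>R u"
proof -
  define Q where "Q B \<longleftrightarrow> pairwise orthogonal B \<and> (\<forall>u\<in>B. norm u = 1 \<and> (\<exists>c. T u = c *\<^sub>R u))" for B
  have ind: "independent B" if "Q B" for B
    using that by (intro pairwise_orthogonal_independent) (auto simp: Q_def)
  have "Q {}" by (simp add: Q_def)
  \<comment> \<open>Orthonormal sets are independent, which bounds their cardinality by the
    dimension; \<open>Suc\<close> makes the bound strict, as the existence of a maximum asks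
    for.\<close>
  moreover have "\<forall>B. Q B \<longrightarrow> card B < Suc DIM('a)"
    using ind independent_bound by (auto simp: less_Suc_eq_le)
  ultimately obtain B where B: "Q B" and max: "\<And>B'. Q B' \<Longrightarrow> card B' \<le> card B"
    using ex_has_greatest_nat[of Q "{}" card "Suc DIM('a)"] by blast
  have fin: "finite B" using ind[OF B] independent_bound by blast
  define V where "V = {x. \<forall>b\<in>B. x \<bullet> b = 0}"
  have V: "subspace V"
    by (auto simp: V_def subspace_def inner_add_left)
  have inv: "T x \<in> V" if "x \<in> V" for x
    using that B by (fastforce simp: V_def Q_def adj)
  have "V = {0}"
  proof (rule ccontr)
    assume "V \<noteq> {0}"
    then obtain u c where u: "u \<in> V" "norm u = 1" "T u = c *\<^sub>R u"
      using self_adjoint_eigenvector_in_subspace[OF lin adj V inv] by blast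
    have "u \<notin> B" using u by (auto simp: V_def)
    moreover have "Q (insert u B)"
      using B u unfolding Q_def V_def
      by (auto intro!: pairwise_orthogonal_insert simp: orthogonal_def)
    ultimately show False using max[of "insert u B"] fin by simp
  qed
  have "span B = UNIV"
  proof -
    have "x \<in> span B" for x
    proof -
      obtain y z where yz: "y \<in> span B" "\<And>w. w \<in> span B \<Longrightarrow> orthogonal z w" "x = y + z"
        using orthogonal_subspace_decomp_exists[of B x] by blast
      then have "z \<in> V" by (auto simp: V_def orthogonal_def span_base)
      then show ?thesis using yz \<open>V = {0}\<close> by simp
    qed
    then show ?thesis by blast
  qed
  then have "card B = DIM('a)"
    using dim_eq_card[of B UNIV] ind[OF B] by simp
  then show ?thesis
    using that[of B] B fin by (auto simp: Q_def)
qed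

lemma symmetric_matrix_inner:
  fixes S :: "real^'n^'n"
  assumes "transpose S = S"
  shows "(S *v x) \<bullet> y = x \<bullet> (S *v y)"
  by (metis assms dot_lmul_matrix transpose_matrix_vector)

text \<open>Indexing the eigenvectors by \<open>'n\<close> itself lets them be the rows of a square
  matrix and lets products over eigenvectors be compared with products over coordinates.\<close>

lemma symmetric_matrix_orthonormal_eigenbasis:
  fixes S :: "real^'n^'n"
  assumes "transpose S = S"
  obtains u :: "'n \<Rightarrow> real^'n" and d
  where "\<And>i j. u i \<bullet> u j = (if i = j then 1 else 0)" "\<And>i. S *v u i = d i *\<^sub>R u i"
proof -
  obtain B :: "(real^'n) set" where B: "pairwise orthogonal B" "finite B" "card B = CARD('n)"
    "\<And>u. u \<in> B \<Longrightarrow> norm u = 1" "\<And>u. u \<in> B \<Longrightarrow> \<exists>c. S *v u = c *\<^sub>R u"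
    using self_adjoint_orthonormal_eigenbasis[of "(*v) S"] symmetric_matrix_inner[OF assms]
    by auto
  then obtain u where u: "bij_betw u (UNIV::'n set) B"
    using finite_same_card_bij[of "UNIV::'n set" B] by auto
  then have uB: "u i \<in> B" and inj: "inj u" for i
    by (auto simp: bij_betw_def)
  have "u i \<bullet> u j = (if i = j then 1 else 0)" for i j
    using B(1) B(4)[OF uB] uB inj by (auto simp: pairwise_def orthogonal_def dot_square_norm inj_eq)
  moreover have "\<exists>d. \<forall>i. S *v u i = d i *\<^sub>R u i"
    using B(5)[OF uB] by (intro choice) blast
  ultimately show ?thesis using that by blast
qed

section \<open>Traces and norms of orthogonal projections\<close>

lemma matrix_diff_ldistrib: "(A::real^'n^'m) ** (B - C) = A ** B - A ** C"
  by (simp add: matrix_matrix_mult_def vec_eq_iff right_diff_distrib sum_subtractf)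

lemma matrix_diff_rdistrib: "(B - C) ** (A::real^'n^'m) = B ** A - C ** A"
  by (simp add: matrix_matrix_mult_def vec_eq_iff left_diff_distrib sum_subtractf)

lemma trace_transpose_mult_nonneg: "trace (transpose B ** (B::real^'n^'m)) \<ge> 0"
  by (simp add: trace_def matrix_matrix_mult_def transpose_def sum_nonneg)

text \<open>The difference \<open>trace C - trace (A ** C)\<close> is the squared Frobenius norm of
  \<open>C - A ** C\<close>.\<close>

lemma trace_projection_mult_le:
  fixes A C :: "real^'n^'n"
  assumes A: "transpose A = A" "A ** A = A" and C: "transpose C = C" "C ** C = C"
  shows "trace (A ** C) \<le> trace C"
proof -
  let ?B = "C - A ** C"
  have "transpose ?B = C - C ** A"
    using A C by (simp add: transpose_def matrix_matrix_mult_def vec_eq_iff mult.commute)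
  then have "transpose ?B ** ?B = (C - C ** A) ** (C - A ** C)" by simp
  also have "\<dots> = C - C ** A ** C"
    using A C matrix_mul_assoc[of C A A]
    by (simp add: matrix_diff_ldistrib matrix_diff_rdistrib matrix_mul_assoc)
  finally have "trace (transpose ?B ** ?B) = trace C - trace (C ** A ** C)"
    by (simp add: trace_sub)
  also have "trace (C ** A ** C) = trace (A ** C)"
    using C by (metis matrix_mul_assoc trace_mul_sym)
  finally show ?thesis
    using trace_transpose_mult_nonneg[of ?B] by simp
qed

text \<open>The right-hand side equals \<open>trace A + trace C - 2 * trace (A ** C)\<close>, and
  \<open>trace (A ** C)\<close> is at most each of the two traces.\<close>

lemma abs_trace_projection_diff_le:
  fixes A C :: "real^'n^'n"
  assumes A: "transpose A = A" "A ** A = A" and C: "transpose C = C" "C ** C = C"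
  shows "\<bar>trace (A - C)\<bar> \<le> trace ((A - C) ** (A - C))"
proof -
  have "(A - C) ** (A - C) = A - C ** A - A ** C + C"
    using A C by (simp add: matrix_diff_ldistrib matrix_diff_rdistrib)
  then have "trace ((A - C) ** (A - C)) = trace A + trace C - 2 * trace (A ** C)"
    using trace_mul_sym[of A C] by (simp add: trace_sub trace_add)
  then show ?thesis
    using trace_projection_mult_le[OF A C] trace_projection_mult_le[OF C A] trace_mul_sym[of A C]
    by (simp add: trace_sub)
qed

lemma norm_projection_le:
  fixes A :: "real^'n^'n"
  assumes "transpose A = A" "A ** A = A"
  shows "norm (A *v x) \<le> norm x" and "x \<bullet> (A *v x) = (norm (A *v x))\<^sup>2"
proof -
  show eq: "x \<bullet> (A *v x) = (norm (A *v x))\<^sup>2"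
    using symmetric_matrix_inner[OF assms(1), of x "A *v x"] assms(2)
    by (simp add: matrix_vector_mul_assoc power2_norm_eq_inner)
  have "(norm (A *v x))\<^sup>2 \<le> norm x * norm (A *v x)"
    using eq norm_cauchy_schwarz[of x "A *v x"] by simp
  then show "norm (A *v x) \<le> norm x"
    by (cases "norm (A *v x) = 0") (simp_all add: power2_eq_square)
qed

text \<open>The eigenvalue is the difference of the squared norms of \<open>A *v u\<close> and
  \<open>C *v u\<close>, both of which lie between 0 and 1.\<close>

lemma projection_diff_eigenvalue_bound:
  fixes A C :: "real^'n^'n"
  assumes A: "transpose A = A" "A ** A = A" and C: "transpose C = C" "C ** C = C"
    and u: "norm u = 1" "(A - C) *v u = d *\<^sub>R u"
  shows "\<bar>d\<bar> \<le> 1"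
proof -
  have "d = u \<bullet> ((A - C) *v u)"
    using u by (simp add: dot_square_norm)
  also have "\<dots> = (norm (A *v u))\<^sup>2 - (norm (C *v u))\<^sup>2"
    using norm_projection_le[OF A, of u] norm_projection_le[OF C, of u]
    by (simp add: matrix_vector_mult_diff_rdistrib inner_diff_right)
  finally show ?thesis
    using norm_projection_le(1)[OF A, of u] norm_projection_le(1)[OF C, of u] u
    by (smt (verit) norm_ge_zero power_le_one zero_le_power2)
qed

section \<open>Trace and inner product in an orthonormal basis\<close>

text \<open>Orthonormality says that the transpose is a right inverse; for a square matrix it is
  then a left inverse as well.\<close>

lemma orthonormal_rows_transpose_mult:
  fixes u :: "'n \<Rightarrow> real^'n"
  assumes u: "\<And>i j. u i \<bullet> u j = (if i = j then 1 else 0)"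
  shows "transpose (\<chi> i. u i) ** (\<chi> i. u i) = mat 1"
proof -
  have "(\<chi> i. u i) ** transpose (\<chi> i. u i) = mat 1"
    using u by (simp add: matrix_matrix_mult_def transpose_def mat_def vec_eq_iff inner_vec_def)
  then show ?thesis
    by (simp add: matrix_left_right_inverse)
qed

text \<open>With the \<open>u i\<close> as rows of \<open>Q\<close> the sum is the trace of
  \<open>Q ** (S ** transpose Q)\<close>, and cyclicity of the trace removes
  \<open>Q\<close>.\<close>

lemma trace_eq_sum_orthonormal:
  fixes S :: "real^'n^'n" and u :: "'n \<Rightarrow> real^'n"
  assumes u: "\<And>i j. u i \<bullet> u j = (if i = j then 1 else 0)"
  shows "trace S = (\<Sum>i\<in>UNIV. u i \<bullet> (S *v u i))"
proof -
  define Q where "Q = (\<chi> i. u i)"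
  have Q: "transpose Q ** Q = mat 1"
    unfolding Q_def by (rule orthonormal_rows_transpose_mult[OF u])
  have "(\<Sum>i\<in>UNIV. u i \<bullet> (S *v u i)) = trace (Q ** (S ** transpose Q))"
    by (simp add: trace_def Q_def matrix_matrix_mult_def transpose_def inner_vec_def
        matrix_vector_mult_def)
  also have "\<dots> = trace S"
    using Q by (metis matrix_mul_assoc matrix_mul_rid trace_mul_sym)
  finally show ?thesis by simp
qed

text \<open>Parseval's identity: the matrix with rows \<open>u i\<close> preserves inner
  products.\<close>

lemma inner_eq_sum_orthonormal:
  fixes u :: "'n \<Rightarrow> real^'n"
  assumes u: "\<And>i j. u i \<bullet> u j = (if i = j then 1 else 0)"
  shows "x \<bullet> y = (\<Sum>i\<in>UNIV. (u i \<bullet> x) * (u i \<bullet> y))"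
proof -
  define Q where "Q = (\<chi> i. u i)"
  have Q: "transpose Q ** Q = mat 1"
    unfolding Q_def by (rule orthonormal_rows_transpose_mult[OF u])
  have "(\<Sum>i\<in>UNIV. (u i \<bullet> x) * (u i \<bullet> y)) = (Q *v x) \<bullet> (Q *v y)"
    by (simp add: Q_def inner_vec_def matrix_vector_mult_def)
  also have "\<dots> = x \<bullet> y"
    by (metis Q dot_lmul_matrix matrix_vector_mul_assoc matrix_vector_mul_lid transpose_matrix_vector)
  finally show ?thesis by simp
qed

section \<open>Gaussian exponential moments of quadratic forms\<close>

text \<open>Completing the square turns the integrand into \<open>c\<close> times the normal density
  with mean \<open>m\<close> and standard deviation \<open>\<tau>\<close>, which integrates to 1.
  The condition on \<open>p\<close> makes \<open>k\<close>, and so the new variance,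
  positive.\<close>

lemma nn_integral_exp_quadratic_normal:
  assumes \<sigma>: "\<sigma> > 0" and p: "2 * p * \<sigma>\<^sup>2 < 1"
  shows "(\<integral>\<^sup>+ s. ennreal (exp (p * s\<^sup>2 + q * s)) \<partial>density lborel (normal_density 0 \<sigma>))
    = ennreal (exp (q\<^sup>2 * \<sigma>\<^sup>2 / (2 * (1 - 2 * p * \<sigma>\<^sup>2))) / sqrt (1 - 2 * p * \<sigma>\<^sup>2))"
proof -
  define k where "k = 1 - 2 * p * \<sigma>\<^sup>2"
  have k: "k > 0" using p by (simp add: k_def)
  define \<tau> where "\<tau> = \<sigma> / sqrt k"
  define m where "m = q * \<sigma>\<^sup>2 / k"
  define c where "c = exp (q\<^sup>2 * \<sigma>\<^sup>2 / (2 * k)) / sqrt k"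
  have \<tau>: "\<tau> > 0" "\<tau>\<^sup>2 = \<sigma>\<^sup>2 / k"
    using \<sigma> k by (auto simp: \<tau>_def power_divide)
  have eq: "normal_density 0 \<sigma> s * exp (p * s\<^sup>2 + q * s) = c * normal_density m \<tau> s" for s
  proof -
    have "- s\<^sup>2 / (2 * \<sigma>\<^sup>2) + (p * s\<^sup>2 + q * s) = - k * s\<^sup>2 / (2 * \<sigma>\<^sup>2) + q * s"
      using \<sigma> by (simp add: k_def field_simps)
    also have "\<dots> = q\<^sup>2 * \<sigma>\<^sup>2 / (2 * k) + - (s - m)\<^sup>2 / (2 * \<tau>\<^sup>2)"
      using \<sigma> k unfolding \<tau> m_def by (simp add: field_simps power2_eq_square)
    finally have "exp (- s\<^sup>2 / (2 * \<sigma>\<^sup>2)) * exp (p * s\<^sup>2 + q * s)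
      = exp (q\<^sup>2 * \<sigma>\<^sup>2 / (2 * k)) * exp (- (s - m)\<^sup>2 / (2 * \<tau>\<^sup>2))"
      by (simp only: exp_add[symmetric])
    moreover have "1 / sqrt (2 * pi * \<sigma>\<^sup>2) = 1 / sqrt k * (1 / sqrt (2 * pi * \<tau>\<^sup>2))"
      using \<sigma> k unfolding \<tau> by (simp add: real_sqrt_mult real_sqrt_divide)
    ultimately show ?thesis
      unfolding normal_density_def c_def by (simp add: field_simps)
  qed
  interpret N: prob_space "density lborel (normal_density m \<tau>)"
    using \<tau>(1) by (rule prob_space_normal_density)
  have one: "(\<integral>\<^sup>+ s. ennreal (normal_density m \<tau> s) \<partial>lborel) = 1"
    using N.emeasure_space_1 by (simp add: emeasure_density)
  have "(\<integral>\<^sup>+ s. ennreal (exp (p * s\<^sup>2 + q * s)) \<partial>density lborel (normal_density 0 \<sigma>))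
    = (\<integral>\<^sup>+ s. ennreal (normal_density 0 \<sigma> s) * ennreal (exp (p * s\<^sup>2 + q * s)) \<partial>lborel)"
    by (simp add: nn_integral_density)
  also have "\<dots> = (\<integral>\<^sup>+ s. ennreal c * ennreal (normal_density m \<tau> s) \<partial>lborel)"
    using k by (intro nn_integral_cong) (simp add: ennreal_mult[symmetric] eq c_def)
  also have "\<dots> = ennreal c"
    by (simp add: nn_integral_cmult one)
  finally show ?thesis by (simp add: c_def k_def)
qed

text \<open>The squares \<open>(u i \<bullet> \<xi>)\<^sup>2\<close> are linearised by auxiliary standard normal variables \<open>s i\<close> via
  \<open>exp (\<gamma>\<^sup>2 g\<^sup>2 / 2) = E exp (\<gamma> g s)\<close>; Tonelli's theorem then leaves exponentials of linear
  functions of \<open>\<xi>\<close>, whose expectation depends only on the norm of the coefficient vector.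
  The shift by \<open>K\<close> makes all quadratic coefficients nonnegative.\<close>

lemma (in prob_space) nn_integral_exp_quadratic_orthonormal:
  fixes \<xi> :: "'a \<Rightarrow> real^'n" and u :: "'n \<Rightarrow> real^'n" and \<alpha> \<beta> :: "'n \<Rightarrow> real"
  assumes \<sigma>: "\<sigma> > 0"
    and indep: "indep_vars (\<lambda>_. borel) (\<lambda>i \<omega>. \<xi> \<omega> $ i) UNIV"
    and dist: "\<And>i. distributed M lborel (\<lambda>\<omega>. \<xi> \<omega> $ i) (normal_density 0 \<sigma>)"
    and u: "\<And>i j. u i \<bullet> u j = (if i = j then 1 else 0)"
  shows "(\<integral>\<^sup>+ \<omega>. ennreal (exp (\<Sum>i\<in>UNIV. \<alpha> i * (u i \<bullet> \<xi> \<omega>)\<^sup>2 + \<beta> i * (u i \<bullet> \<xi> \<omega>))) \<partial>M)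
    = (\<Prod>i\<in>UNIV. \<integral>\<^sup>+ g. ennreal (exp (\<alpha> i * g\<^sup>2 + \<beta> i * g)) \<partial>density lborel (normal_density 0 \<sigma>))"
proof -
  define N where "N \<tau> = density lborel (\<lambda>x. ennreal (normal_density 0 \<tau> x))" for \<tau>
  define Q where "Q = PiM (UNIV::'n set) (\<lambda>_. N 1)"
  have [measurable_cong, simp]: "sets (N \<tau>) = sets borel" for \<tau>
    by (simp add: N_def)
  have [measurable]: "(\<lambda>\<omega>. \<xi> \<omega> $ i) \<in> borel_measurable M" for i
    using distributed_measurable[OF dist] by simp
  have inner: "u i \<bullet> x = (\<Sum>k\<in>UNIV. u i $ k * x $ k)" for i x
    by (simp add: inner_vec_def)
  interpret N1: prob_space "N 1"
    unfolding N_def by (rule prob_space_normal_density) simp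
  interpret N\<sigma>: prob_space "N \<sigma>"
    unfolding N_def by (rule prob_space_normal_density) fact
  interpret QP: product_prob_space "\<lambda>_. N 1" "UNIV::'n set" ..
  interpret Q: prob_space Q unfolding Q_def by (rule QP.prob_space_axioms)
  interpret MQ: pair_sigma_finite M Q ..
  interpret NN: pair_sigma_finite "N \<sigma>" "N 1" ..
  define K where "K = (\<Sum>i\<in>UNIV. \<bar>\<alpha> i\<bar>)"
  have K: "K \<ge> 0" "\<alpha> i + K \<ge> 0" for i
    using member_le_sum[of i UNIV "\<lambda>i. \<bar>\<alpha> i\<bar>"] by (auto simp: K_def intro: sum_nonneg)
  \<comment> \<open>Chosen so that
    \<open>(\<gamma> i * g)\<^sup>2 / 2 = (\<alpha> i + K) * g\<^sup>2\<close>: averaging over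
    \<open>s\<close> then cancels the shift \<open>- K * g\<^sup>2\<close> and leaves
    \<open>\<alpha> i * g\<^sup>2\<close>.\<close>
  define \<gamma> where "\<gamma> i = sqrt (2 * (\<alpha> i + K))" for i
  define G where "G t = (\<integral>\<^sup>+ g. ennreal (exp (- K * g\<^sup>2 + t * g)) \<partial>N \<sigma>)" for t
  define w where "w s k = (\<Sum>i\<in>UNIV. (\<gamma> i * s i + \<beta> i) * u i $ k)" for s k
  have lin: "ennreal (exp (\<alpha> i * g\<^sup>2 + \<beta> i * g))
      = (\<integral>\<^sup>+ s. ennreal (exp (- K * g\<^sup>2 + (\<gamma> i * s + \<beta> i) * g)) \<partial>N 1)" for i g
  proof -
    have "(\<integral>\<^sup>+ s. ennreal (exp (- K * g\<^sup>2 + (\<gamma> i * s + \<beta> i) * g)) \<partial>N 1)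
      = (\<integral>\<^sup>+ s. ennreal (exp (- K * g\<^sup>2 + \<beta> i * g)) * ennreal (exp (0 * s\<^sup>2 + (\<gamma> i * g) * s)) \<partial>N 1)"
      by (simp add: ennreal_mult[symmetric] exp_add[symmetric] algebra_simps)
    also have "\<dots> = ennreal (exp (- K * g\<^sup>2 + \<beta> i * g)) * ennreal (exp ((\<gamma> i * g)\<^sup>2 / 2))"
      by (subst nn_integral_cmult)
        (simp_all add: N_def nn_integral_exp_quadratic_normal[of 1 0, simplified])
    also have "\<dots> = ennreal (exp (\<alpha> i * g\<^sup>2 + \<beta> i * g))"
      using K(2)[of i]
      by (simp add: ennreal_mult[symmetric] exp_add[symmetric] \<gamma>_def algebra_simps power_mult_distrib)
    finally show ?thesis by simp
  qed
  have Gval: "G t = ennreal (exp (t\<^sup>2 * \<sigma>\<^sup>2 / (2 * (1 + 2 * K * \<sigma>\<^sup>2))) / sqrt (1 + 2 * K * \<sigma>\<^sup>2))" for t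
  proof -
    have "2 * (- K) * \<sigma>\<^sup>2 < 1"
      using K(1) by (smt (verit) mult_nonneg_nonneg zero_le_power2 mult_minus_left mult_minus_right)
    from nn_integral_exp_quadratic_normal[OF \<sigma> this] show ?thesis
      by (simp add: G_def N_def)
  qed
  \<comment> \<open>\<open>G t\<close> is a constant times the exponential of a multiple of
    \<open>t\<^sup>2\<close>, so a product of its values sees only the sum of squares. This is the
    rotation invariance of the Gaussian vector in the form used below.\<close>
  have Gprod: "(\<Prod>k\<in>UNIV. G (a k)) = (\<Prod>k\<in>UNIV. G (b k))"
    if "(\<Sum>k\<in>UNIV. (a k)\<^sup>2) = (\<Sum>k\<in>UNIV. (b k)\<^sup>2)" for a b :: "'n \<Rightarrow> real"
  proof -
    have "(\<Prod>k\<in>UNIV. G (a k)) = ennreal (exp ((\<Sum>k\<in>UNIV. (a k)\<^sup>2) * \<sigma>\<^sup>2 / (2 * (1 + 2 * K * \<sigma>\<^sup>2)))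
        / sqrt (1 + 2 * K * \<sigma>\<^sup>2) ^ CARD('n))" for a :: "'n \<Rightarrow> real"
      unfolding Gval
      using K(1)
      by (subst prod_ennreal)
        (auto simp: prod_dividef exp_sum[symmetric] sum_divide_distrib sum_distrib_right)
    then show ?thesis using that by simp
  qed
  \<comment> \<open>\<open>w s\<close> lists the coordinates of the vector whose coefficients in the
    basis \<open>u\<close> are \<open>\<gamma> i * s i + \<beta> i\<close>, so both sides are its
    squared length.\<close>
  have ws: "(\<Sum>k\<in>UNIV. (w s k)\<^sup>2) = (\<Sum>i\<in>UNIV. (\<gamma> i * s i + \<beta> i)\<^sup>2)" for s
  proof -
    let ?v = "\<Sum>i\<in>UNIV. (\<gamma> i * s i + \<beta> i) *\<^sub>R u i"
    have "(\<Sum>k\<in>UNIV. (w s k)\<^sup>2) = ?v \<bullet> ?v"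
      by (simp add: w_def inner_vec_def power2_eq_square)
    also have "\<dots> = (\<Sum>i\<in>UNIV. (\<gamma> i * s i + \<beta> i)\<^sup>2)"
      by (simp add: inner_sum_left inner_sum_right u power2_eq_square if_distrib cong: if_cong)
    finally show ?thesis .
  qed
  have "(\<integral>\<^sup>+ \<omega>. ennreal (exp (\<Sum>i\<in>UNIV. \<alpha> i * (u i \<bullet> \<xi> \<omega>)\<^sup>2 + \<beta> i * (u i \<bullet> \<xi> \<omega>))) \<partial>M)
    = (\<integral>\<^sup>+ \<omega>. (\<integral>\<^sup>+ s. (\<Prod>k\<in>UNIV. ennreal (exp (- K * (\<xi> \<omega> $ k)\<^sup>2 + w s k * \<xi> \<omega> $ k))) \<partial>Q) \<partial>M)"
  proof (rule nn_integral_cong)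
    fix \<omega>
    have "ennreal (exp (\<Sum>i\<in>UNIV. \<alpha> i * (u i \<bullet> \<xi> \<omega>)\<^sup>2 + \<beta> i * (u i \<bullet> \<xi> \<omega>)))
      = (\<Prod>i\<in>UNIV. \<integral>\<^sup>+ s. ennreal (exp (- K * (u i \<bullet> \<xi> \<omega>)\<^sup>2 + (\<gamma> i * s + \<beta> i) * (u i \<bullet> \<xi> \<omega>))) \<partial>N 1)"
      unfolding lin[symmetric] by (simp add: prod_ennreal exp_sum)
    also have "\<dots> = (\<integral>\<^sup>+ s. (\<Prod>i\<in>UNIV. ennreal (exp (- K * (u i \<bullet> \<xi> \<omega>)\<^sup>2 + (\<gamma> i * s i + \<beta> i) * (u i \<bullet> \<xi> \<omega>)))) \<partial>Q)"
      unfolding Q_def by (rule QP.product_nn_integral_prod[symmetric]) auto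
    also have "\<dots> = (\<integral>\<^sup>+ s. (\<Prod>k\<in>UNIV. ennreal (exp (- K * (\<xi> \<omega> $ k)\<^sup>2 + w s k * \<xi> \<omega> $ k))) \<partial>Q)"
    proof (rule nn_integral_cong)
      fix s :: "'n \<Rightarrow> real"
      have "(\<Sum>i\<in>UNIV. (\<gamma> i * s i + \<beta> i) * (u i \<bullet> \<xi> \<omega>)) = (\<Sum>k\<in>UNIV. w s k * \<xi> \<omega> $ k)"
        unfolding w_def inner sum_distrib_left sum_distrib_right
        by (subst sum.swap) (simp add: mult.assoc)
      \<comment> \<open>Since the shift has the same coefficient in all directions, Parseval's
        identity makes it \<open>- K\<close> times the squared norm of the noise in either
        basis.\<close>
      moreover have "(\<Sum>i\<in>UNIV. - K * (u i \<bullet> \<xi> \<omega>)\<^sup>2) = (\<Sum>k\<in>UNIV. - K * (\<xi> \<omega> $ k)\<^sup>2)"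
        using inner_eq_sum_orthonormal[OF u, of "\<xi> \<omega>" "\<xi> \<omega>"]
        by (simp only: sum_distrib_left[symmetric]) (simp add: inner_vec_def power2_eq_square)
      ultimately have "(\<Sum>i\<in>UNIV. - K * (u i \<bullet> \<xi> \<omega>)\<^sup>2 + (\<gamma> i * s i + \<beta> i) * (u i \<bullet> \<xi> \<omega>))
          = (\<Sum>k\<in>UNIV. - K * (\<xi> \<omega> $ k)\<^sup>2 + w s k * \<xi> \<omega> $ k)"
        by (simp only: sum.distrib)
      then show "(\<Prod>i\<in>UNIV. ennreal (exp (- K * (u i \<bullet> \<xi> \<omega>)\<^sup>2 + (\<gamma> i * s i + \<beta> i) * (u i \<bullet> \<xi> \<omega>))))
          = (\<Prod>k\<in>UNIV. ennreal (exp (- K * (\<xi> \<omega> $ k)\<^sup>2 + w s k * \<xi> \<omega> $ k)))"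
        by (simp only: prod_ennreal exp_ge_zero exp_sum[symmetric] finite)
    qed
    finally show "ennreal (exp (\<Sum>i\<in>UNIV. \<alpha> i * (u i \<bullet> \<xi> \<omega>)\<^sup>2 + \<beta> i * (u i \<bullet> \<xi> \<omega>)))
      = (\<integral>\<^sup>+ s. (\<Prod>k\<in>UNIV. ennreal (exp (- K * (\<xi> \<omega> $ k)\<^sup>2 + w s k * \<xi> \<omega> $ k))) \<partial>Q)" .
  qed
  also have "\<dots> = (\<integral>\<^sup>+ s. (\<integral>\<^sup>+ \<omega>. (\<Prod>k\<in>UNIV. ennreal (exp (- K * (\<xi> \<omega> $ k)\<^sup>2 + w s k * \<xi> \<omega> $ k))) \<partial>M) \<partial>Q)"
    unfolding w_def Q_def
    by (rule MQ.Fubini'[symmetric, unfolded Q_def]) measurable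
  also have "\<dots> = (\<integral>\<^sup>+ s. (\<Prod>i\<in>UNIV. G (\<gamma> i * s i + \<beta> i)) \<partial>Q)"
  proof (rule nn_integral_cong)
    fix s :: "'n \<Rightarrow> real"
    have "indep_vars (\<lambda>_. borel) (\<lambda>k \<omega>. ennreal (exp (- K * (\<xi> \<omega> $ k)\<^sup>2 + w s k * \<xi> \<omega> $ k))) UNIV"
      by (rule indep_vars_compose2[OF indep]) measurable
    then have "(\<integral>\<^sup>+ \<omega>. (\<Prod>k\<in>UNIV. ennreal (exp (- K * (\<xi> \<omega> $ k)\<^sup>2 + w s k * \<xi> \<omega> $ k))) \<partial>M)
      = (\<Prod>k\<in>UNIV. \<integral>\<^sup>+ \<omega>. ennreal (exp (- K * (\<xi> \<omega> $ k)\<^sup>2 + w s k * \<xi> \<omega> $ k)) \<partial>M)"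
      by (intro indep_vars_nn_integral) auto
    also have "\<dots> = (\<Prod>k\<in>UNIV. G (w s k))"
    proof (rule prod.cong[OF refl])
      fix k
      show "(\<integral>\<^sup>+ \<omega>. ennreal (exp (- K * (\<xi> \<omega> $ k)\<^sup>2 + w s k * \<xi> \<omega> $ k)) \<partial>M) = G (w s k)"
        unfolding G_def N_def distributed_distr_eq_density[OF dist, of k, symmetric]
        by (subst nn_integral_distr) auto
    qed
    also have "\<dots> = (\<Prod>i\<in>UNIV. G (\<gamma> i * s i + \<beta> i))"
      by (rule Gprod) (rule ws)
    finally show "(\<integral>\<^sup>+ \<omega>. (\<Prod>k\<in>UNIV. ennreal (exp (- K * (\<xi> \<omega> $ k)\<^sup>2 + w s k * \<xi> \<omega> $ k))) \<partial>M)
      = (\<Prod>i\<in>UNIV. G (\<gamma> i * s i + \<beta> i))" .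
  qed
  also have "\<dots> = (\<Prod>i\<in>UNIV. \<integral>\<^sup>+ s. G (\<gamma> i * s + \<beta> i) \<partial>N 1)"
    unfolding Q_def
    by (rule QP.product_nn_integral_prod) (auto simp: Gval)
  \<comment> \<open>The linearisation is undone in each factor separately, after exchanging its two
    integrals.\<close>
  also have "\<dots> = (\<Prod>i\<in>UNIV. \<integral>\<^sup>+ g. ennreal (exp (\<alpha> i * g\<^sup>2 + \<beta> i * g)) \<partial>N \<sigma>)"
    unfolding lin G_def
    by (intro prod.cong refl NN.Fubini') measurable
  finally show ?thesis by (simp add: N_def)
qed

section \<open>Exponential moment of the increments\<close>

text \<open>This treats one eigendirection, with eigenvalue \<open>d\<close> and shift
  \<open>v\<close>. The negative term in \<open>v\<close> of \<open>r\<close> absorbs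
  \<open>q\<close>. In the rest, \<open>- ln k / 2\<close> exceeds its first-order part
  \<open>a / 64\<close> by at most \<open>d\<^sup>2 / 256\<close>, exactly the margin that the
  penalty leaves after the variance error is paid.\<close>

lemma gaussian_increment_exponent_bound:
  fixes d v \<sigma> :: real
  assumes \<sigma>: "\<sigma> > 0" and d: "\<bar>d\<bar> \<le> 1"
  defines "p \<equiv> (2 * d - d\<^sup>2 / 2) / (64 * \<sigma>\<^sup>2)" and "q \<equiv> (2 - d) * v / (64 * \<sigma>\<^sup>2)"
    and "r \<equiv> (- v\<^sup>2 / 2 - 2 * \<sigma>\<^sup>2 * d + \<sigma>\<^sup>2 * d\<^sup>2 / 4) / (64 * \<sigma>\<^sup>2)"
  shows "2 * p * \<sigma>\<^sup>2 < 1"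
    and "exp r * (exp (q\<^sup>2 * \<sigma>\<^sup>2 / (2 * (1 - 2 * p * \<sigma>\<^sup>2))) / sqrt (1 - 2 * p * \<sigma>\<^sup>2)) \<le> 1"
proof -
  define a where "a = 2 * d - d\<^sup>2 / 2"
  define k where "k = 1 - a / 32"
  have "2 * p * \<sigma>\<^sup>2 = a / 32"
    using \<sigma> by (simp add: p_def a_def)
  then have pk: "1 - 2 * p * \<sigma>\<^sup>2 = k" by (simp add: k_def)
  \<comment> \<open>The first product amounts to \<open>a \<le> 3/2\<close>, the second to
    \<open>(2 - d)\<^sup>2 \<le> 9\<close>.\<close>
  have dd: "0 \<le> (1 - d) * (3 - d)" "0 \<le> (1 + d) * (5 - d)"
    using d by (intro mult_nonneg_nonneg; simp)+
  have k: "k \<ge> 61 / 64"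
    using dd(1) by (simp add: k_def a_def power2_eq_square field_simps)
  then have k0: "k > 0" by simp
  show "2 * p * \<sigma>\<^sup>2 < 1" using pk k0 by simp
  have "(2 - d)\<^sup>2 \<le> 64 * k"
    using dd(2) k by (simp add: algebra_simps power2_eq_square)
  then have "(2 - d)\<^sup>2 * v\<^sup>2 \<le> 64 * k * v\<^sup>2"
    by (rule mult_right_mono) simp
  have v: "q\<^sup>2 * \<sigma>\<^sup>2 / (2 * k) \<le> v\<^sup>2 / (128 * \<sigma>\<^sup>2)"
  proof -
    have "q\<^sup>2 * \<sigma>\<^sup>2 / (2 * k) = (2 - d)\<^sup>2 * v\<^sup>2 / (8192 * k * \<sigma>\<^sup>2)"
      using \<sigma> k0 by (simp add: q_def field_simps power2_eq_square)
    also have "\<dots> \<le> 64 * k * v\<^sup>2 / (8192 * k * \<sigma>\<^sup>2)"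
      using \<open>(2 - d)\<^sup>2 * v\<^sup>2 \<le> 64 * k * v\<^sup>2\<close> k0 by (intro divide_right_mono) auto
    also have "\<dots> = v\<^sup>2 / (128 * \<sigma>\<^sup>2)"
      using k0 by simp
    finally show ?thesis .
  qed
  \<comment> \<open>The factor 25/4 comes from \<open>2 - d / 2 \<le> 5/2\<close> and stays below
    \<open>8 * k\<close>, which is at least 61/8.\<close>
  have "a\<^sup>2 \<le> (25/4) * d\<^sup>2"
  proof -
    have "(2 - d / 2)\<^sup>2 \<le> (5/2)\<^sup>2"
      using d by (intro power_mono) auto
    then have "d\<^sup>2 * (2 - d / 2)\<^sup>2 \<le> d\<^sup>2 * (25/4)"
      by (intro mult_left_mono) (auto simp: power2_eq_square)
    then show ?thesis by (simp add: a_def algebra_simps power2_eq_square)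
  qed
  also have "\<dots> \<le> 8 * k * d\<^sup>2"
    using k by (intro mult_right_mono) auto
  finally have a: "a\<^sup>2 / (2048 * k) \<le> d\<^sup>2 / 256"
    using k0 by (simp add: field_simps)
  have "- ln k \<le> (a / 32) / k"
    using ln_le_minus_one[of "1 / k"] k0 by (simp add: ln_div k_def field_simps)
  also have "(a / 32) / k = a / 32 + 2 * (a\<^sup>2 / (2048 * k))"
    using k0 by (simp add: k_def field_simps power2_eq_square)
  finally have "- ln k / 2 \<le> d / 32 - d\<^sup>2 / 256"
    using a a_def by linarith
  moreover have "r = - v\<^sup>2 / (128 * \<sigma>\<^sup>2) - (d / 32 - d\<^sup>2 / 256)"
    using \<sigma> by (simp add: r_def field_simps)
  ultimately have "r + (q\<^sup>2 * \<sigma>\<^sup>2 / (2 * k) - ln k / 2) \<le> 0"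
    using v by simp
  moreover have "sqrt k = exp (ln k / 2)"
    using k0 by (simp add: ln_sqrt[symmetric])
  then have "exp r * (exp (q\<^sup>2 * \<sigma>\<^sup>2 / (2 * k)) / sqrt k) = exp (r + (q\<^sup>2 * \<sigma>\<^sup>2 / (2 * k) - ln k / 2))"
    by (simp add: exp_add exp_diff)
  ultimately show "exp r * (exp (q\<^sup>2 * \<sigma>\<^sup>2 / (2 * (1 - 2 * p * \<sigma>\<^sup>2))) / sqrt (1 - 2 * p * \<sigma>\<^sup>2)) \<le> 1"
    unfolding pk by simp
qed

text \<open>For \<open>D = A j - A k\<close> and \<open>D *v z + v = mu_j A b y j - mu_j A b y k\<close> this bounds the contribution
  of the pair \<open>(j, k)\<close>; the last summand accounts for the error of the variance estimator.\<close>

definition increment :: "real \<Rightarrow> real^'n^'n \<Rightarrow> real^'n \<Rightarrow> real^'n \<Rightarrow> real" where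
  "increment \<sigma> D v z = 2 * (z \<bullet> (D *v z)) - 2 * \<sigma>\<^sup>2 * trace D + 2 * (z \<bullet> v)
     - (norm (D *v z + v))\<^sup>2 / 2 + \<sigma>\<^sup>2 / 4 * trace (D ** D)"

text \<open>All terms become diagonal in the eigenbasis. The factor \<open>2 - d i\<close> collects
  2 from \<open>z \<bullet> v\<close> and \<open>- d i\<close> from the cross term of the squared
  norm.\<close>

lemma increment_eq_sum_eigenbasis:
  fixes D :: "real^'n^'n" and u :: "'n \<Rightarrow> real^'n"
  assumes D: "transpose D = D"
    and u: "\<And>i j. u i \<bullet> u j = (if i = j then 1 else 0)" and d: "\<And>i. D *v u i = d i *\<^sub>R u i"
  shows "increment \<sigma> D v z = (\<Sum>i\<in>UNIV. (2 * d i - (d i)\<^sup>2 / 2) * (u i \<bullet> z)\<^sup>2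
    + (2 - d i) * (u i \<bullet> v) * (u i \<bullet> z)
    + (- (u i \<bullet> v)\<^sup>2 / 2 - 2 * \<sigma>\<^sup>2 * d i + \<sigma>\<^sup>2 * (d i)\<^sup>2 / 4))"
proof -
  have uD: "u i \<bullet> (D *v z) = d i * (u i \<bullet> z)" for i z
    using symmetric_matrix_inner[OF D, of "u i" z] by (simp add: d)
  have "trace D = (\<Sum>i\<in>UNIV. d i)"
    by (simp add: trace_eq_sum_orthonormal[OF u] d u)
  moreover have "trace (D ** D) = (\<Sum>i\<in>UNIV. (d i)\<^sup>2)"
    by (simp add: trace_eq_sum_orthonormal[OF u] matrix_vector_mul_assoc[symmetric] uD d u power2_eq_square)
  moreover have "z \<bullet> (D *v z) = (\<Sum>i\<in>UNIV. (u i \<bullet> z) * (d i * (u i \<bullet> z)))"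
    by (subst inner_eq_sum_orthonormal[OF u]) (simp add: uD)
  moreover have "z \<bullet> v = (\<Sum>i\<in>UNIV. (u i \<bullet> z) * (u i \<bullet> v))"
    by (rule inner_eq_sum_orthonormal[OF u])
  moreover have "(norm (D *v z + v))\<^sup>2 = (\<Sum>i\<in>UNIV. (d i * (u i \<bullet> z) + u i \<bullet> v) * (d i * (u i \<bullet> z) + u i \<bullet> v))"
    unfolding power2_norm_eq_inner
    by (subst inner_eq_sum_orthonormal[OF u]) (simp add: uD inner_add_right)
  ultimately show ?thesis
    unfolding increment_def
    by (simp add: sum_distrib_left sum_subtractf[symmetric] sum.distrib[symmetric] sum_divide_distrib)
      (intro sum.cong refl, simp add: field_simps power2_eq_square)
qed

text \<open>In an eigenbasis of \<open>A - C\<close> the expectation factorises over the directions.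
  Once the constant \<open>exp (sum r UNIV)\<close> is distributed over the factors, each of them is
  at most 1.\<close>

lemma (in prob_space) increment_exp_moment_le_1:
  fixes \<xi> :: "'a \<Rightarrow> real^'n" and A C :: "real^'n^'n"
  assumes \<sigma>: "\<sigma> > 0"
    and indep: "indep_vars (\<lambda>_. borel) (\<lambda>i \<omega>. \<xi> \<omega> $ i) UNIV"
    and dist: "\<And>i. distributed M lborel (\<lambda>\<omega>. \<xi> \<omega> $ i) (normal_density 0 \<sigma>)"
    and A: "transpose A = A" "A ** A = A" and C: "transpose C = C" "C ** C = C"
  shows "(\<integral>\<^sup>+ \<omega>. ennreal (exp (increment \<sigma> (A - C) v (\<xi> \<omega>) / (64 * \<sigma>\<^sup>2))) \<partial>M) \<le> 1"
proof -
  have D: "transpose (A - C) = A - C"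
    using A(1) C(1) by (simp add: transpose_def vec_eq_iff)
  obtain u :: "'n \<Rightarrow> real^'n" and d
    where u: "\<And>i j. u i \<bullet> u j = (if i = j then 1 else 0)" and d: "\<And>i. (A - C) *v u i = d i *\<^sub>R u i"
    using symmetric_matrix_orthonormal_eigenbasis[OF D] by blast
  have d1: "\<bar>d i\<bar> \<le> 1" for i
    using projection_diff_eigenvalue_bound[OF A C _ d] u[of i i] by (simp add: norm_eq_1)
  \<comment> \<open>\<open>p i\<close>, \<open>q i\<close> and \<open>r i\<close> are the quantities
    of \<open>gaussian_increment_exponent_bound\<close> with \<open>d i\<close> and
    \<open>u i \<bullet> v\<close> for \<open>d\<close> and \<open>v\<close>.\<close>
  define p where "p i = (2 * d i - (d i)\<^sup>2 / 2) / (64 * \<sigma>\<^sup>2)" for i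
  define q where "q i = (2 - d i) * (u i \<bullet> v) / (64 * \<sigma>\<^sup>2)" for i
  define r where "r i = (- (u i \<bullet> v)\<^sup>2 / 2 - 2 * \<sigma>\<^sup>2 * d i + \<sigma>\<^sup>2 * (d i)\<^sup>2 / 4) / (64 * \<sigma>\<^sup>2)" for i
  have rp: "increment \<sigma> (A - C) v z / (64 * \<sigma>\<^sup>2)
      = sum r UNIV + (\<Sum>i\<in>UNIV. p i * (u i \<bullet> z)\<^sup>2 + q i * (u i \<bullet> z))" for z
    unfolding increment_eq_sum_eigenbasis[OF D u d] sum_divide_distrib sum.distrib[symmetric] p_def q_def r_def
    by (intro sum.cong refl) (simp add: add_divide_distrib)
  have [measurable]: "(\<lambda>\<omega>. \<xi> \<omega> $ i) \<in> borel_measurable M" for i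
    using distributed_measurable[OF dist] by simp
  have "(\<integral>\<^sup>+ \<omega>. ennreal (exp (increment \<sigma> (A - C) v (\<xi> \<omega>) / (64 * \<sigma>\<^sup>2))) \<partial>M)
    = (\<integral>\<^sup>+ \<omega>. ennreal (exp (sum r UNIV)) * ennreal (exp (\<Sum>i\<in>UNIV. p i * (u i \<bullet> \<xi> \<omega>)\<^sup>2 + q i * (u i \<bullet> \<xi> \<omega>))) \<partial>M)"
    unfolding rp by (simp add: exp_add ennreal_mult)
  also have "\<dots> = ennreal (exp (sum r UNIV)) * (\<integral>\<^sup>+ \<omega>. ennreal (exp (\<Sum>i\<in>UNIV. p i * (u i \<bullet> \<xi> \<omega>)\<^sup>2 + q i * (u i \<bullet> \<xi> \<omega>))) \<partial>M)"
    by (rule nn_integral_cmult) (simp add: inner_vec_def)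
  also have "\<dots> = ennreal (exp (sum r UNIV)) *
      (\<Prod>i\<in>UNIV. \<integral>\<^sup>+ g. ennreal (exp (p i * g\<^sup>2 + q i * g)) \<partial>density lborel (normal_density 0 \<sigma>))"
    by (subst nn_integral_exp_quadratic_orthonormal[OF \<sigma> indep dist u]) simp_all
  also have "\<dots> = ennreal (exp (sum r UNIV)) * (\<Prod>i\<in>UNIV.
      ennreal (exp ((q i)\<^sup>2 * \<sigma>\<^sup>2 / (2 * (1 - 2 * p i * \<sigma>\<^sup>2))) / sqrt (1 - 2 * p i * \<sigma>\<^sup>2)))"
    using gaussian_increment_exponent_bound(1)[OF \<sigma> d1]
    by (subst nn_integral_exp_quadratic_normal[OF \<sigma>]) (simp_all add: p_def)
  also have "\<dots> = (\<Prod>i\<in>UNIV. ennreal (exp (r i) *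
      (exp ((q i)\<^sup>2 * \<sigma>\<^sup>2 / (2 * (1 - 2 * p i * \<sigma>\<^sup>2))) / sqrt (1 - 2 * p i * \<sigma>\<^sup>2))))"
    by (simp add: exp_sum prod_ennreal[symmetric] prod.distrib[symmetric] ennreal_mult'[symmetric])
  also have "\<dots> \<le> 1"
    using gaussian_increment_exponent_bound(2)[OF \<sigma> d1]
    by (intro prod_le_1) (auto simp: p_def q_def r_def)
  finally show ?thesis .
qed

section \<open>Deterministic oracle inequality for the penalised minimiser\<close>

text \<open>Divide by \<open>t\<close> and let it tend to 0. The range \<open>t \<le> 1\<close> is
  that of the convex combinations to which this will be applied.\<close>

lemma nonneg_of_quadratic_nonneg:
  fixes c e :: real
  assumes "\<And>t. 0 < t \<Longrightarrow> t \<le> 1 \<Longrightarrow> 0 \<le> t * c + t\<^sup>2 * e"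
  shows "0 \<le> c"
proof (rule ccontr)
  assume "\<not> 0 \<le> c"
  \<comment> \<open>The summand \<open>\<bar>c\<bar>\<close> gives \<open>t \<le> 1\<close>; as the
    denominator exceeds \<open>e\<close>, also \<open>t * e < - c\<close>.\<close>
  define t where "t = - c / (\<bar>e\<bar> + \<bar>c\<bar> + 1)"
  have t: "0 < t" "t \<le> 1" and te: "t * (\<bar>e\<bar> + \<bar>c\<bar> + 1) = - c"
    using \<open>\<not> 0 \<le> c\<close> by (auto simp: t_def field_simps)
  have "0 \<le> t * (c + t * e)"
    using assms[OF t] by (simp add: algebra_simps power2_eq_square)
  then have "0 \<le> c + t * e" using t by (simp add: zero_le_mult_iff)
  moreover have "t * e < t * (\<bar>e\<bar> + \<bar>c\<bar> + 1)"
    using t by (intro mult_strict_left_mono) auto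
  ultimately show False using te by simp
qed

lemma mu_theta_eq_sum: "mu_theta A b y \<theta> = (\<Sum>j\<in>UNIV. \<theta> $ j *\<^sub>R mu_j A b y j)"
proof -
  have "(\<Sum>j\<in>UNIV. \<theta> $ j *\<^sub>R A j) *v y = (\<Sum>j\<in>UNIV. \<theta> $ j *\<^sub>R (A j *v y))"
    by (simp add: vec_eq_iff matrix_vector_mult_def sum_distrib_right sum_distrib_left mult.assoc)
      (subst sum.swap, simp)
  then show ?thesis
    by (simp add: mu_theta_def mu_j_def A_theta_def b_theta_def scaleR_add_right sum.distrib)
qed

lemma trace_A_theta: "trace (A_theta A \<theta>) = (\<Sum>j\<in>UNIV. \<theta> $ j * trace (A j))"
  by (simp add: trace_def A_theta_def sum_distrib_left) (rule sum.swap)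

text \<open>\<open>pen\<close> is a variance: the weighted mean of the squared norms minus the
  squared norm of the mean. Half of it removes half of the leading square, and everything else is
  linear in \<open>\<theta>\<close>.\<close>

lemma Wpen_eq:
  assumes "\<theta> \<in> Lambda_simplex"
  shows "Wpen A b y s \<theta> = (norm (mu_theta A b y \<theta>))\<^sup>2 / 2
    + (\<Sum>j\<in>UNIV. \<theta> $ j * ((norm (mu_j A b y j))\<^sup>2 / 2 - 2 * (y \<bullet> mu_j A b y j) + 2 * s * trace (A j)))"
proof -
  let ?m = "mu_theta A b y \<theta>" and ?\<mu> = "mu_j A b y"
  have lin: "(\<Sum>j\<in>UNIV. \<theta> $ j * (z \<bullet> ?\<mu> j)) = z \<bullet> ?m" for z
    by (simp add: mu_theta_eq_sum inner_sum_right)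
  have "pen A b y \<theta> = (\<Sum>j\<in>UNIV. \<theta> $ j * (norm ?m)\<^sup>2 - 2 * (\<theta> $ j * (?m \<bullet> ?\<mu> j)) + \<theta> $ j * (norm (?\<mu> j))\<^sup>2)"
    unfolding pen_def power2_norm_eq_inner
    by (intro sum.cong refl) (simp add: algebra_simps inner_diff_left inner_diff_right inner_commute)
  also have "\<dots> = (\<Sum>j\<in>UNIV. \<theta> $ j) * (norm ?m)\<^sup>2 - 2 * (?m \<bullet> ?m) + (\<Sum>j\<in>UNIV. \<theta> $ j * (norm (?\<mu> j))\<^sup>2)"
    by (simp add: sum.distrib sum_subtractf sum_distrib_right sum_distrib_left[symmetric] lin)
  also have "\<dots> = (\<Sum>j\<in>UNIV. \<theta> $ j * (norm (?\<mu> j))\<^sup>2) - (norm ?m)\<^sup>2"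
    using assms by (simp add: Lambda_simplex_def power2_norm_eq_inner)
  finally have pen: "pen A b y \<theta> = (\<Sum>j\<in>UNIV. \<theta> $ j * (norm (?\<mu> j))\<^sup>2) - (norm ?m)\<^sup>2" .
  have "(\<Sum>j\<in>UNIV. \<theta> $ j * ((norm (?\<mu> j))\<^sup>2 / 2 - 2 * (y \<bullet> ?\<mu> j) + 2 * s * trace (A j)))
    = (\<Sum>j\<in>UNIV. \<theta> $ j * (norm (?\<mu> j))\<^sup>2) / 2 - 2 * (\<Sum>j\<in>UNIV. \<theta> $ j * (y \<bullet> ?\<mu> j))
      + 2 * s * (\<Sum>j\<in>UNIV. \<theta> $ j * trace (A j))"
    by (simp add: sum_distrib_left sum_divide_distrib sum.distrib[symmetric] sum_subtractf[symmetric])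
      (intro sum.cong refl, simp add: algebra_simps)
  then show ?thesis
    unfolding Wpen_def pen trace_A_theta lin by (simp add: field_simps)
qed

text \<open>Moving the minimiser towards vertex \<open>k\<close> of the simplex cannot decrease the
  criterion; the resulting derivative inequality rearranges to the claim.\<close>

lemma Wpen_argmin_oracle_inequality:
  fixes A :: "'m::finite \<Rightarrow> real^'n^'n"
  assumes \<theta>: "\<theta> \<in> Lambda_simplex"
    and min: "\<And>\<theta>'. \<theta>' \<in> Lambda_simplex \<Longrightarrow> Wpen A b (f + z) s \<theta> \<le> Wpen A b (f + z) s \<theta>'"
  shows "(norm (mu_theta A b (f + z) \<theta> - f))\<^sup>2 \<le> (norm (mu_j A b (f + z) k - f))\<^sup>2
    + (\<Sum>j\<in>UNIV. \<theta> $ j * (2 * (z \<bullet> (mu_j A b (f + z) j - mu_j A b (f + z) k))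
        - 2 * s * trace (A j - A k)
        - (norm (mu_j A b (f + z) j - mu_j A b (f + z) k))\<^sup>2 / 2))"
proof -
  define y where "y = f + z"
  define \<mu> where "\<mu> = mu_j A b y"
  define m where "m = mu_theta A b y \<theta>"
  define l where "l j = (norm (\<mu> j))\<^sup>2 / 2 - 2 * (y \<bullet> \<mu> j) + 2 * s * trace (A j)" for j
  define L where "L = (\<Sum>j\<in>UNIV. \<theta> $ j * l j)"
  have sum1: "(\<Sum>j\<in>UNIV. \<theta> $ j) = 1" and \<theta>0: "\<And>j. \<theta> $ j \<ge> 0"
    using \<theta> by (auto simp: Lambda_simplex_def)
  have W: "Wpen A b y s \<theta> = (norm m)\<^sup>2 / 2 + L"
    using Wpen_eq[OF \<theta>, of A b y s] by (simp add: m_def L_def l_def \<mu>_def)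
  \<comment> \<open>The right-hand side is the one-sided derivative of the criterion at
    \<open>\<theta>\<close> in the direction of vertex \<open>k\<close>.\<close>
  have "0 \<le> m \<bullet> (\<mu> k - m) + l k - L"
  proof (rule nonneg_of_quadratic_nonneg)
    fix t :: real assume t: "0 < t" "t \<le> 1"
    define \<theta>' where "\<theta>' = (1 - t) *\<^sub>R \<theta> + t *\<^sub>R axis k 1"
    have ax: "(\<Sum>j\<in>UNIV. axis k 1 $ j * h j) = h k" for h :: "'m \<Rightarrow> real"
      by (simp add: axis_def if_distrib[of "\<lambda>x. x * _"] cong: if_cong)
    have ax': "(\<Sum>j\<in>UNIV. axis k (1::real) $ j *\<^sub>R h j) = h k" for h :: "'m \<Rightarrow> real^'n"
      by (simp add: axis_def if_distrib[of "\<lambda>x. x *\<^sub>R _"] cong: if_cong)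
    have \<theta>': "\<theta>' \<in> Lambda_simplex"
      using t \<theta>0 sum1 ax[of "\<lambda>_. 1"]
      by (auto simp: Lambda_simplex_def \<theta>'_def sum.distrib sum_distrib_left[symmetric] axis_def)
    have "mu_theta A b y \<theta>' = (1 - t) *\<^sub>R m + t *\<^sub>R (\<Sum>j\<in>UNIV. axis k 1 $ j *\<^sub>R \<mu> j)"
      by (simp add: mu_theta_eq_sum m_def \<mu>_def \<theta>'_def scaleR_add_left sum.distrib scaleR_sum_right)
    then have m': "mu_theta A b y \<theta>' = m + t *\<^sub>R (\<mu> k - m)"
      by (simp add: ax' algebra_simps)
    have "(\<Sum>j\<in>UNIV. \<theta>' $ j * l j) = (1 - t) * L + t * (\<Sum>j\<in>UNIV. axis k 1 $ j * l j)"
      by (simp add: L_def \<theta>'_def distrib_right sum.distrib sum_distrib_left mult.assoc)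
    then have "Wpen A b y s \<theta>' = (norm (m + t *\<^sub>R (\<mu> k - m)))\<^sup>2 / 2 + (1 - t) * L + t * l k"
      using Wpen_eq[OF \<theta>', of A b y s] by (simp add: m' ax l_def \<mu>_def)
    moreover have "(norm (m + t *\<^sub>R (\<mu> k - m)))\<^sup>2
        = (norm m)\<^sup>2 + 2 * t * (m \<bullet> (\<mu> k - m)) + t\<^sup>2 * (norm (\<mu> k - m))\<^sup>2"
      by (simp only: power2_norm_eq_inner inner_add_left inner_add_right inner_scaleR_left
          inner_scaleR_right inner_commute[of "\<mu> k - m" m]) (simp add: power2_eq_square algebra_simps)
    moreover have "Wpen A b y s \<theta> \<le> Wpen A b y s \<theta>'"
      using min[OF \<theta>'] by (simp add: y_def)
    ultimately show "0 \<le> t * (m \<bullet> (\<mu> k - m) + l k - L) + t\<^sup>2 * ((norm (\<mu> k - m))\<^sup>2 / 2)"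
      by (simp add: W algebra_simps)
  qed
  \<comment> \<open>The part \<open>- (norm (\<mu> j))\<^sup>2 / 2\<close> of each square is
    absorbed into \<open>- l j\<close>, so the weighted sum involves only \<open>m\<close>,
    \<open>L\<close> and the data of \<open>k\<close>.\<close>
  moreover have "(\<Sum>j\<in>UNIV. \<theta> $ j * (2 * (z \<bullet> (\<mu> j - \<mu> k)) - 2 * s * trace (A j - A k)
        - (norm (\<mu> j - \<mu> k))\<^sup>2 / 2))
      = 2 * (y \<bullet> (\<mu> k - m)) + 2 * (z \<bullet> (m - \<mu> k)) + l k - L + m \<bullet> \<mu> k - (norm (\<mu> k))\<^sup>2"
  proof -
    have lin: "(\<Sum>j\<in>UNIV. \<theta> $ j * (x \<bullet> \<mu> j)) = x \<bullet> m" for x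
      by (simp add: m_def \<mu>_def mu_theta_eq_sum inner_sum_right)
    have "\<theta> $ j * (2 * (z \<bullet> (\<mu> j - \<mu> k)) - 2 * s * trace (A j - A k) - (norm (\<mu> j - \<mu> k))\<^sup>2 / 2)
      = 2 * (\<theta> $ j * (z \<bullet> \<mu> j)) - 2 * (\<theta> $ j * (y \<bullet> \<mu> j)) + \<theta> $ j * (\<mu> k \<bullet> \<mu> j) - \<theta> $ j * l j
        + \<theta> $ j * (l k + 2 * (y \<bullet> \<mu> k) - 2 * (z \<bullet> \<mu> k) - (norm (\<mu> k))\<^sup>2)" for j
      unfolding l_def power2_norm_eq_inner trace_sub
      by (simp add: inner_diff_left inner_diff_right inner_commute field_simps)
    then show ?thesis
      by (simp add: sum.distrib sum_subtractf sum_distrib_left[symmetric] sum_distrib_right[symmetric]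
          lin sum1 L_def[symmetric] inner_diff_right inner_commute[of m "\<mu> k"])
  qed
  \<comment> \<open>The derivative inequality bounds \<open>l k - L\<close> below by
    \<open>m \<bullet> m - m \<bullet> \<mu> k\<close>. As \<open>y - z = f\<close>, what remains is
    the difference of the two squared losses.\<close>
  ultimately have "(norm (m - f))\<^sup>2 \<le> (norm (\<mu> k - f))\<^sup>2
    + (\<Sum>j\<in>UNIV. \<theta> $ j * (2 * (z \<bullet> (\<mu> j - \<mu> k)) - 2 * s * trace (A j - A k) - (norm (\<mu> j - \<mu> k))\<^sup>2 / 2))"
    unfolding power2_norm_eq_inner y_def
    by (simp add: inner_diff_left inner_diff_right inner_add_left inner_commute algebra_simps)
  then show ?thesis by (simp add: m_def \<mu>_def y_def)
qed

text \<open>Replacing \<open>s\<close> by the true variance costs at most the last summand of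
  \<open>increment\<close>, its factor 1/4 being twice the relative accuracy 1/8. The weights sum to
  1, so their average inherits the bound \<open>c\<close>.\<close>

lemma prediction_le_of_increment_le:
  fixes A :: "'m::finite \<Rightarrow> real^'n^'n"
  assumes \<theta>: "\<theta> \<in> Lambda_simplex"
    and min: "\<And>\<theta>'. \<theta>' \<in> Lambda_simplex \<Longrightarrow> Wpen A b (f + z) s \<theta> \<le> Wpen A b (f + z) s \<theta>'"
    and A: "\<And>j. transpose (A j) = A j" "\<And>j. A j ** A j = A j"
    and s: "\<bar>\<sigma>\<^sup>2 - s\<bar> \<le> \<sigma>\<^sup>2 / 8"
    and c: "\<And>j. increment \<sigma> (A j - A k) ((A j - A k) *v f + b j - b k) z \<le> c"
  shows "(norm (mu_theta A b (f + z) \<theta> - f))\<^sup>2 \<le> (norm (mu_j A b (f + z) k - f))\<^sup>2 + c"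
proof -
  let ?\<mu> = "mu_j A b (f + z)"
  have "2 * (z \<bullet> (?\<mu> j - ?\<mu> k)) - 2 * s * trace (A j - A k) - (norm (?\<mu> j - ?\<mu> k))\<^sup>2 / 2 \<le> c" for j
  proof -
    let ?D = "A j - A k" and ?v = "(A j - A k) *v f + b j - b k"
    have \<mu>: "?\<mu> j - ?\<mu> k = ?D *v z + ?v"
      by (simp add: mu_j_def algebra_simps)
    have "2 * (\<sigma>\<^sup>2 - s) * trace ?D \<le> 2 * (\<bar>\<sigma>\<^sup>2 - s\<bar> * \<bar>trace ?D\<bar>)"
      using abs_ge_self[of "(\<sigma>\<^sup>2 - s) * trace ?D"] by (simp only: abs_mult mult.assoc)
    also have "\<dots> \<le> 2 * (\<sigma>\<^sup>2 / 8 * trace (?D ** ?D))"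
      using s abs_trace_projection_diff_le[OF A A, of j k] by (intro mult_left_mono mult_mono) auto
    finally have "- 2 * s * trace ?D \<le> - 2 * \<sigma>\<^sup>2 * trace ?D + \<sigma>\<^sup>2 / 4 * trace (?D ** ?D)"
      by (simp add: algebra_simps)
    then show ?thesis
      using c[of j] unfolding increment_def \<mu> by (simp add: inner_add_right)
  qed
  then have "(\<Sum>j\<in>UNIV. \<theta> $ j * (2 * (z \<bullet> (?\<mu> j - ?\<mu> k)) - 2 * s * trace (A j - A k)
        - (norm (?\<mu> j - ?\<mu> k))\<^sup>2 / 2)) \<le> (\<Sum>j\<in>UNIV. \<theta> $ j * c)"
    using \<theta> by (intro sum_mono mult_left_mono) (auto simp: Lambda_simplex_def)
  also have "\<dots> = c"
    using \<theta> by (simp add: Lambda_simplex_def sum_distrib_right[symmetric])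
  finally show ?thesis
    using Wpen_argmin_oracle_inequality[OF \<theta> min, of k] by linarith
qed

section \<open>Union bound over pairs of estimators\<close>

theorem theorem6p2:
  fixes P :: "'w measure"
    and \<xi> :: "'w \<Rightarrow> real ^ 'n::finite"
    and f :: "real ^ 'n"
    and \<sigma> :: real
    and A :: "'m::finite \<Rightarrow> real ^ 'n ^ 'n"
    and b :: "'m \<Rightarrow> real ^ 'n"
    and s2 :: "'w \<Rightarrow> real"
    and \<theta>hat :: "'w \<Rightarrow> real ^ 'm"
    and x :: real
  assumes "prob_space P"
    and "CARD('m) \<ge> 2"
    and "\<sigma> > 0"
    and "prob_space.indep_vars P (\<lambda>_. borel) (\<lambda>i \<omega>. \<xi> \<omega> $ i) UNIV"
    and "\<And>i. distributed P lborel (\<lambda>\<omega>. \<xi> \<omega> $ i) (normal_density 0 \<sigma>)"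
    and "\<And>j. transpose (A j) = A j"
    and "\<And>j. A j ** A j = A j"
    and "s2 \<in> borel_measurable P"
    and "measure P {\<omega>\<in>space P. \<bar>\<sigma>\<^sup>2 - s2 \<omega>\<bar> > \<sigma>\<^sup>2 / 8} < 1"
    and "\<And>\<omega>. \<omega> \<in> space P \<Longrightarrow> \<theta>hat \<omega> \<in> Lambda_simplex \<and>
           (\<forall>\<theta>\<in>Lambda_simplex. Wpen A b (f + \<xi> \<omega>) (s2 \<omega>) (\<theta>hat \<omega>) \<le> Wpen A b (f + \<xi> \<omega>) (s2 \<omega>) \<theta>)"
    and "x > 0"
  shows "\<exists>E\<in>sets P.
           E \<subseteq> {\<omega>\<in>space P.
                 (norm (mu_theta A b (f + \<xi> \<omega>) (\<theta>hat \<omega>) - f))\<^sup>2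
                 \<le> Min (range (\<lambda>j. (norm (mu_j A b (f + \<xi> \<omega>) j - f))\<^sup>2))
                   + 64 * \<sigma>\<^sup>2 * (x + 2 * ln (real CARD('m)))} \<and>
           measure P E \<ge> 1 - measure P {\<omega>\<in>space P. \<bar>\<sigma>\<^sup>2 - s2 \<omega>\<bar> > \<sigma>\<^sup>2 / 8} - 2 * exp (- x)"
proof -
  interpret prob_space P by fact
  note \<sigma> = assms(3) and A = assms(6,7) and \<theta> = assms(10)
  note [measurable] = assms(8)
  have [measurable]: "(\<lambda>\<omega>. \<xi> \<omega> $ i) \<in> borel_measurable P" for i
    using distributed_measurable[OF assms(5)] by simp
  define c where "c = 64 * \<sigma>\<^sup>2 * (x + 2 * ln (real CARD('m)))"
  define Z where "Z j k \<omega> = increment \<sigma> (A j - A k) ((A j - A k) *v f + b j - b k) (\<xi> \<omega>)" for j k \<omega>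
  define F where "F = {\<omega>\<in>space P. \<bar>\<sigma>\<^sup>2 - s2 \<omega>\<bar> > \<sigma>\<^sup>2 / 8}"
  define G where "G p = {\<omega>\<in>space P. Z (fst p) (snd p) \<omega> \<ge> c}" for p
  have Zm [measurable]: "Z j k \<in> borel_measurable P" for j k
    unfolding Z_def increment_def power2_norm_eq_inner
    by (simp add: inner_vec_def matrix_vector_mult_def)
  have [measurable]: "F \<in> sets P" "G p \<in> sets P" for p
    unfolding F_def G_def by measurable
  have G: "measure P (G p) \<le> exp (- x) / (real CARD('m))\<^sup>2" for p
  proof -
    have "emeasure P (G p) \<le> ennreal (exp (- (1 / (64 * \<sigma>\<^sup>2)) * c)) *
        (\<integral>\<^sup>+ \<omega>. ennreal (exp (1 / (64 * \<sigma>\<^sup>2) * Z (fst p) (snd p) \<omega>)) * indicator (space P) \<omega> \<partial>P)"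
      unfolding G_def using \<sigma> by (intro Chernoff_ineq_nn_integral_ge) auto
    also have "\<dots> \<le> ennreal (exp (- (1 / (64 * \<sigma>\<^sup>2)) * c)) * 1"
      using increment_exp_moment_le_1[OF \<sigma> assms(4,5) A A]
      by (intro mult_left_mono) (auto simp: Z_def mult.commute cong: nn_integral_cong)
    \<comment> \<open>The summand \<open>2 * ln (real CARD('m))\<close> in \<open>c\<close> supplies
      the factor that pays for the union over all pairs.\<close>
    also have "- (1 / (64 * \<sigma>\<^sup>2)) * c = - x - 2 * ln (real CARD('m))"
      using \<sigma> by (simp add: c_def)
    also have "exp (- x - 2 * ln (real CARD('m))) = exp (- x) / (real CARD('m))\<^sup>2"
      using assms(2) by (simp add: exp_diff exp_double)
    finally show ?thesis
      by (simp add: emeasure_eq_measure)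
  qed
  \<comment> \<open>\<open>E\<close> is built from the noise and \<open>s2\<close> alone:
    \<open>\<theta>hat\<close> is not assumed measurable, so the set of outcomes satisfying the
    bound need not be an event.\<close>
  define E where "E = space P - (F \<union> (\<Union>p\<in>UNIV. G p))"
  have E: "E \<in> sets P" unfolding E_def by measurable
  have "measure P (F \<union> (\<Union>p\<in>UNIV. G p)) \<le> measure P F + measure P (\<Union>p\<in>UNIV. G p)"
    by (intro measure_Un_le) auto
  also have "measure P (\<Union>p\<in>UNIV. G p) \<le> (\<Sum>p\<in>UNIV. measure P (G p))"
    by (intro finite_measure_subadditive_finite) auto
  also have "\<dots> \<le> (\<Sum>p\<in>(UNIV::('m \<times> 'm) set). exp (- x) / (real CARD('m))\<^sup>2)"
    by (intro sum_mono G)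
  also have "\<dots> = exp (- x)"
    by (simp add: power2_eq_square)
  finally have "measure P E \<ge> 1 - measure P F - exp (- x)"
    unfolding E_def by (subst prob_compl) auto
  \<comment> \<open>The union bound costs \<open>exp (- x)\<close>, which is relaxed here to the
    stated \<open>2 * exp (- x)\<close>.\<close>
  also have "1 - measure P F - exp (- x) \<ge> 1 - measure P F - 2 * exp (- x)"
    by simp
  finally have "measure P E \<ge> 1 - measure P F - 2 * exp (- x)" .
  moreover have "E \<subseteq> {\<omega>\<in>space P. (norm (mu_theta A b (f + \<xi> \<omega>) (\<theta>hat \<omega>) - f))\<^sup>2
      \<le> Min (range (\<lambda>j. (norm (mu_j A b (f + \<xi> \<omega>) j - f))\<^sup>2)) + c}"
  proof safe
    fix \<omega> assume \<omega>: "\<omega> \<in> E"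
    then show sp: "\<omega> \<in> space P" by (simp add: E_def)
    have s: "\<bar>\<sigma>\<^sup>2 - s2 \<omega>\<bar> \<le> \<sigma>\<^sup>2 / 8"
      using \<omega> by (auto simp: E_def F_def)
    have Z: "Z j k \<omega> \<le> c" for j k
    proof -
      have "\<omega> \<notin> G (j, k)" using \<omega> by (auto simp: E_def)
      then show ?thesis using sp by (simp add: G_def)
    qed
    have "(norm (mu_theta A b (f + \<xi> \<omega>) (\<theta>hat \<omega>) - f))\<^sup>2 \<le> (norm (mu_j A b (f + \<xi> \<omega>) k - f))\<^sup>2 + c" for k
      using \<theta>[OF sp] Z by (intro prediction_le_of_increment_le[OF _ _ A s]) (auto simp: Z_def)
    \<comment> \<open>On \<open>E\<close> the bound holds for all \<open>k\<close> at once, so it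
      may be used at a minimising index that depends on the outcome.\<close>
    moreover obtain k where "Min (range (\<lambda>j. (norm (mu_j A b (f + \<xi> \<omega>) j - f))\<^sup>2))
        = (norm (mu_j A b (f + \<xi> \<omega>) k - f))\<^sup>2"
      using Min_in[of "range (\<lambda>j. (norm (mu_j A b (f + \<xi> \<omega>) j - f))\<^sup>2)"] by fastforce
    ultimately show "(norm (mu_theta A b (f + \<xi> \<omega>) (\<theta>hat \<omega>) - f))\<^sup>2
        \<le> Min (range (\<lambda>j. (norm (mu_j A b (f + \<xi> \<omega>) j - f))\<^sup>2)) + c"
      by simp
  qed
  ultimately show ?thesis
    using E unfolding c_def F_def by blast
qed

end
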